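(* Let $R_s,R_c>0$, $\gamma=R_c/R_s$, and $\lambda>0$. Let $p(\lambda,\gamma)$ be the probability that the origin $O$ is inside a triangular hole, for sensors distributed as a homogeneous Poisson point process of intensity $\lambda$. If $0<\gamma\le\sqrt3$, then $p(\lambda,\gamma)=0$.
   Context: Sensors (nodes) are points in the plane $\mathbb{R}^2$. Each has sensing radius $R_s$ and communication radius $R_c$. Let $O$ be the origin and $B(x,r)$ the closed disk of center $x$ and radius $r$. Only nodes within distance $R_c$ of $O$ matter, so let $\Phi$ be a homogeneous Poisson point process of intensity $\lambda$ (with respect to Lebesgue measure) on $B(O,R_c)$; border effects are ignored. The origin is inside a triangular hole if and only if (i) every node of $\Phi$ is at distance strictly larger than $R_s$ from $O$, and (ii) there are three nodes $n_0,n_1,n_2\in\Phi$ with pairwise distances at most $R_c$ such that $O$ lies in the triangle (convex hull) with vertices $n_0,n_1,n_2$. Let $p(\lambda,\gamma)$ denote the probability of this event. *)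

theory Defs
  imports "HOL-Probability.Probability"
begin

(* A simple point process on the bounded window W is represented by a random finite set:
   \<Phi> w is the set of points of the realization w, and card (\<Phi> w \<inter> A) is the number of points
   in A.  The mean measure intensity * Lebesgue has no atoms, so multiplicities need not be recorded.
   The Poisson weights are written out because poisson_pmf is specified only for positive rates,
   whereas A may be a null set here (then the count is 0 almost surely, as 0 ^ 0 = 1). *)
locale homogeneous_poisson_process = prob_space M
  for M :: "'w measure" and \<Phi> :: "'w \<Rightarrow> 'a::euclidean_space set"
    and intensity :: real and W :: "'a set" +
  assumes bounded_window: "bounded W"
    and window_borel: "W \<in> sets borel"
    and points_in_window: "\<And>w. w \<in> space M \<Longrightarrow> \<Phi> w \<subseteq> W"
    and finitely_many_points: "\<And>w. w \<in> space M \<Longrightarrow> finite (\<Phi> w)"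
    and count_measurable: "\<And>A. A \<in> sets borel \<Longrightarrow> A \<subseteq> W \<Longrightarrow>
          (\<lambda>w. card (\<Phi> w \<inter> A)) \<in> M \<rightarrow>\<^sub>M count_space UNIV"
    and count_poisson: "\<And>A k. A \<in> sets borel \<Longrightarrow> A \<subseteq> W \<Longrightarrow>
          prob {w \<in> space M. card (\<Phi> w \<inter> A) = k}
            = (intensity * measure lborel A) ^ k / fact k * exp (- (intensity * measure lborel A))"
    and counts_indep: "\<And>\<A>. finite \<A> \<Longrightarrow> \<A> \<subseteq> {A \<in> sets borel. A \<subseteq> W} \<Longrightarrow> disjoint \<A> \<Longrightarrow>
          indep_vars (\<lambda>_. count_space UNIV) (\<lambda>A w. card (\<Phi> w \<inter> A)) \<A>"

definition origin_in_triangular_hole :: "real \<Rightarrow> real \<Rightarrow> (real^2) set \<Rightarrow> bool" where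
  "origin_in_triangular_hole Rs Rc S \<longleftrightarrow>
     (\<forall>n\<in>S. dist 0 n > Rs) \<and>
     (\<exists>n0\<in>S. \<exists>n1\<in>S. \<exists>n2\<in>S. distinct [n0, n1, n2] \<and>
        dist n0 n1 \<le> Rc \<and> dist n1 n2 \<le> Rc \<and> dist n0 n2 \<le> Rc \<and>
        0 \<in> convex hull {n0, n1, n2})"

definition triangular_hole_event ::
    "'w measure \<Rightarrow> ('w \<Rightarrow> (real^2) set) \<Rightarrow> real \<Rightarrow> real \<Rightarrow> 'w set" where
  "triangular_hole_event M \<Phi> Rs Rc = {w \<in> space M. origin_in_triangular_hole Rs Rc (\<Phi> w)}"

end

theory Submission
  imports Defs
begin

text \<open>
  If \<open>a x + b y + c z = 0\<close> with \<open>a + b + c = 1\<close>, then Leibniz's identity reads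
  \<open>a |x|\<^sup>2 + b |y|\<^sup>2 + c |z|\<^sup>2 = ab |x - y|\<^sup>2 + bc |y - z|\<^sup>2 + ac |x - z|\<^sup>2\<close>. Under
  \<open>Rc \<le> sqrt 3 Rs\<close> the right-hand side is at most \<open>3 (ab + bc + ac) Rs\<^sup>2 \<le> Rs\<^sup>2\<close>, while the left-hand
  side exceeds \<open>Rs\<^sup>2\<close> if all three points lie outside the disk of radius \<open>Rs\<close>. So the event is empty.
\<close>

text \<open>Expand the squared norm of the vanishing combination and substitute \<open>2 * (x
  \<bullet> y) = (norm x)\<^sup>2 + (norm y)\<^sup>2 - (dist x y)\<^sup>2\<close>, likewise for the
  other pairs.\<close>

lemma leibniz_barycentre_identity:
  fixes x y z :: "'a::real_inner"
  assumes "a + b + c = 1" and "a *\<^sub>R x + b *\<^sub>R y + c *\<^sub>R z = 0"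
  shows "a * (norm x)\<^sup>2 + b * (norm y)\<^sup>2 + c * (norm z)\<^sup>2
       = a * b * (dist x y)\<^sup>2 + b * c * (dist y z)\<^sup>2 + a * c * (dist x z)\<^sup>2"
proof -
  have c: "c = 1 - a - b"
    using assms(1) by simp
  have "(a *\<^sub>R x + b *\<^sub>R y + c *\<^sub>R z) \<bullet> (a *\<^sub>R x + b *\<^sub>R y + c *\<^sub>R z) = 0"
    by (simp add: assms(2))
  then show ?thesis
    unfolding dist_norm power2_norm_eq_inner c
    by (simp add: inner_add_left inner_add_right inner_diff_left inner_diff_right
        inner_commute algebra_simps)
qed

text \<open>The factor 3 is sharp: an equilateral triangle of side \<open>d\<close> centred at 0 has
  its vertices at distance \<open>d / sqrt 3\<close>.\<close>

lemma zero_in_triangle_vertex_near: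
  fixes x y z :: "'a::real_inner"
  assumes zero: "0 \<in> convex hull {x, y, z}"
    and dist: "dist x y \<le> d" "dist y z \<le> d" "dist x z \<le> d"
    and d: "d\<^sup>2 \<le> 3 * r\<^sup>2" and "0 \<le> r"
  shows "norm x \<le> r \<or> norm y \<le> r \<or> norm z \<le> r"
proof (rule ccontr)
  assume "\<not> ?thesis"
  then have sq: "r\<^sup>2 < (norm x)\<^sup>2" "r\<^sup>2 < (norm y)\<^sup>2" "r\<^sup>2 < (norm z)\<^sup>2"
    using \<open>0 \<le> r\<close> by (auto intro!: power_strict_mono)
  obtain a b c where abc: "0 \<le> a" "0 \<le> b" "0 \<le> c" "a + b + c = 1"
    and comb: "a *\<^sub>R x + b *\<^sub>R y + c *\<^sub>R z = 0"
    using zero unfolding convex_hull_3 by auto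
  note leibniz = leibniz_barycentre_identity[OF abc(4) comb]
  have dist_sq: "(dist x y)\<^sup>2 \<le> 3 * r\<^sup>2" "(dist y z)\<^sup>2 \<le> 3 * r\<^sup>2" "(dist x z)\<^sup>2 \<le> 3 * r\<^sup>2"
    using dist d by (meson order_trans power_mono zero_le_dist)+
  \<comment> \<open>The difference of the two sides is half the sum of the squares of
    \<open>a - b\<close>, \<open>b - c\<close> and \<open>a - c\<close>.\<close>
  have "3 * (a * b + b * c + a * c) \<le> (a + b + c)\<^sup>2"
    using sum_squares_ge_zero[of "a - b" "b - c"] zero_le_square[of "a - c"]
    by (simp add: power2_eq_square algebra_simps)
  then have "3 * (a * b + b * c + a * c) \<le> 1"
    by (simp add: abc(4))
  then have "r\<^sup>2 * (3 * (a * b + b * c + a * c)) \<le> r\<^sup>2"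
    by (rule mult_left_le) simp
  moreover have "a * b * (dist x y)\<^sup>2 + b * c * (dist y z)\<^sup>2 + a * c * (dist x z)\<^sup>2
      \<le> a * b * (3 * r\<^sup>2) + b * c * (3 * r\<^sup>2) + a * c * (3 * r\<^sup>2)"
    using abc dist_sq by (intro add_mono mult_left_mono) auto
  ultimately have upper: "a * (norm x)\<^sup>2 + b * (norm y)\<^sup>2 + c * (norm z)\<^sup>2 \<le> r\<^sup>2"
    unfolding leibniz by (simp add: algebra_simps)
  \<comment> \<open>Single weights may be 0, so each term is only nonnegative. By
    \<open>upper\<close> their sum is at most 0, so all vanish, which forces every weight to be
    0.\<close>
  have "0 \<le> a * ((norm x)\<^sup>2 - r\<^sup>2)" "0 \<le> b * ((norm y)\<^sup>2 - r\<^sup>2)" "0 \<le> c * ((norm z)\<^sup>2 - r\<^sup>2)"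
    using abc sq by auto
  moreover have "a * ((norm x)\<^sup>2 - r\<^sup>2) + b * ((norm y)\<^sup>2 - r\<^sup>2) + c * ((norm z)\<^sup>2 - r\<^sup>2)
      = a * (norm x)\<^sup>2 + b * (norm y)\<^sup>2 + c * (norm z)\<^sup>2 - (a + b + c) * r\<^sup>2"
    by (simp add: algebra_simps)
  ultimately have "a * ((norm x)\<^sup>2 - r\<^sup>2) = 0" "b * ((norm y)\<^sup>2 - r\<^sup>2) = 0"
      "c * ((norm z)\<^sup>2 - r\<^sup>2) = 0"
    using upper unfolding abc(4) by linarith+
  then have "a = 0" "b = 0" "c = 0"
    using sq by auto
  with abc(4) show False
    by simp
qed

lemma not_origin_in_triangular_hole:
  assumes "0 \<le> Rs" and "Rc\<^sup>2 \<le> 3 * Rs\<^sup>2"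
  shows "\<not> origin_in_triangular_hole Rs Rc S"
  using zero_in_triangle_vertex_near[OF _ _ _ _ assms(2,1)]
  unfolding origin_in_triangular_hole_def by (force simp: not_le[symmetric])

theorem theorem1:
  fixes M :: "'w measure" and \<Phi> :: "'w \<Rightarrow> (real^2) set"
    and Rs Rc \<gamma> intensity :: real
  assumes "Rs > 0" and "Rc > 0" and "\<gamma> = Rc / Rs" and "intensity > 0"
    and "homogeneous_poisson_process M \<Phi> intensity (cball 0 Rc)"
    and "0 < \<gamma>" and "\<gamma> \<le> sqrt 3"
  shows "triangular_hole_event M \<Phi> Rs Rc \<in> sets M
       \<and> measure M (triangular_hole_event M \<Phi> Rs Rc) = 0"
proof -
  have "\<gamma>\<^sup>2 \<le> (sqrt 3)\<^sup>2"
    using assms(6,7) by (intro power_mono) auto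
  then have "Rc\<^sup>2 \<le> 3 * Rs\<^sup>2"
    using assms(1,3) by (simp add: power_divide field_simps)
  \<comment> \<open>The event is empty, not merely null, which settles measurability and probability
    at once.\<close>
  then have "triangular_hole_event M \<Phi> Rs Rc = {}"
    using not_origin_in_triangular_hole assms(1)
    unfolding triangular_hole_event_def by auto
  then show ?thesis
    by simp
qed

end
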